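(* Let $n\geq 6$ and let $i$ be an integer with $\lfloor n/3\rfloor+2\leq i\leq \lfloor n/2\rfloor$. Then $$d_a(C_n,i)\leq \sum_{k=3}^{i-1} n\,d(P_{n-k-2},i-k).$$
   Context: $C_n$ denotes the cycle on $n$ vertices and $P_m$ the path on $m$ vertices. A dominating set of a graph $G=(V,E)$ is a set $D\subseteq V$ such that every vertex not in $D$ is adjacent to some vertex of $D$. A dominating set $D$ is accurate if no $|D|$-element subset of $V\setminus D$ is a dominating set of $G$. $d(G,j)$ is the number of dominating sets of $G$ of cardinality $j$ and $d_a(G,j)$ the number of accurate dominating sets of $G$ of cardinality $j$. Empty sums are $0$. *)

theory Defs
  imports Main
begin

record 'a sgraph =
  vertices :: "'a set"
  edges :: "'a set set"

definition finite_simple_graph :: "'a sgraph \<Rightarrow> bool" where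
  "finite_simple_graph G \<longleftrightarrow>
     finite (vertices G) \<and> (\<forall>e\<in>edges G. e \<subseteq> vertices G \<and> card e = 2)"

definition adjacent :: "'a sgraph \<Rightarrow> 'a \<Rightarrow> 'a \<Rightarrow> bool" where
  "adjacent G u v \<longleftrightarrow> {u, v} \<in> edges G"

definition path_graph :: "nat \<Rightarrow> nat sgraph" where
  "path_graph m = \<lparr>vertices = {0..<m}, edges = {{j, j + 1} | j. j + 1 < m}\<rparr>"

(* Meaningful for n \<ge> 3: for n = 1 the only "edge" is a singleton, for n = 2 it is P_2. *)
definition cycle_graph :: "nat \<Rightarrow> nat sgraph" where
  "cycle_graph n = \<lparr>vertices = {0..<n}, edges = {{j, (j + 1) mod n} | j. j < n}\<rparr>"

definition dominating_set :: "'a sgraph \<Rightarrow> 'a set \<Rightarrow> bool" where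
  "dominating_set G D \<longleftrightarrow>
     D \<subseteq> vertices G \<and> (\<forall>v\<in>vertices G - D. \<exists>u\<in>D. adjacent G v u)"

definition accurate_dominating_set :: "'a sgraph \<Rightarrow> 'a set \<Rightarrow> bool" where
  "accurate_dominating_set G D \<longleftrightarrow>
     dominating_set G D \<and>
     \<not> (\<exists>S. S \<subseteq> vertices G - D \<and> card S = card D \<and> dominating_set G S)"

definition num_dominating :: "'a sgraph \<Rightarrow> nat \<Rightarrow> nat" where
  "num_dominating G j = card {D. dominating_set G D \<and> card D = j}"

definition num_accurate_dominating :: "'a sgraph \<Rightarrow> nat \<Rightarrow> nat" where
  "num_accurate_dominating G j = card {D. accurate_dominating_set G D \<and> card D = j}"

lemma finite_simple_graph_path: "finite_simple_graph (path_graph m)"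
  by (auto simp: finite_simple_graph_def path_graph_def)

lemma finite_simple_graph_cycle:
  assumes "n \<ge> 3"
  shows "finite_simple_graph (cycle_graph n)"
proof -
  have "j \<noteq> (j + 1) mod n" if "j < n" for j
    using assms that by (cases "j + 1 = n") auto
  then show ?thesis
    using assms by (auto simp: finite_simple_graph_def cycle_graph_def card_2_iff)
qed

end

theory Submission
  imports Defs
begin

text \<open>
  Let \<open>D\<close> be a dominating set of the cycle with at most half of the vertices. If \<open>D\<close> contained no
  three consecutive vertices, replace each \<open>d \<in> D\<close> by \<open>d + 1\<close> if \<open>d + 1 \<notin> D\<close> and by \<open>d - 1\<close>
  otherwise: this gives a dominating set outside \<open>D\<close> with at most \<open>|D|\<close> elements, which can be
  enlarged to exactly \<open>|D|\<close> elements, so \<open>D\<close> is not accurate. Hence an accurate \<open>D\<close> has a maximal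
  run of some length \<open>k \<ge> 3\<close>. Removing this run and the two gap vertices next to it leaves
  a path on \<open>n - k - 2\<close> vertices which is dominated by the remaining \<open>i - k\<close> elements of \<open>D\<close>. There
  are \<open>n\<close> positions for the run, and \<open>k = i\<close> is impossible since the path is nonempty.
\<close>

section \<open>Domination on cycles and paths in terms of vertex numbers\<close>

lemma dominating_set_mono:
  assumes "dominating_set G S" "S \<subseteq> T" "T \<subseteq> vertices G"
  shows "dominating_set G T"
  using assms unfolding dominating_set_def by blast

text \<open>Adding \<open>n - 1\<close> modulo \<open>n\<close> acts as the predecessor on the
  cycle, without truncation at 0.\<close>

lemma mod_Suc_add_pred: "n > 0 \<Longrightarrow> ((y + 1) mod n + (n - 1)) mod n = y mod (n::nat)"
  by (subst mod_add_left_eq) simp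

lemma mod_add_pred_Suc:
  assumes "n > 0"
  shows "(y + (n - 1) + Suc j) mod n = (y + j) mod (n::nat)"
proof -
  have "y + (n - 1) + Suc j = y + j + n" using assms by simp
  then show ?thesis by (metis mod_add_self2)
qed

text \<open>Listing the closed neighbourhood of \<open>x + 1\<close> instead of \<open>x\<close> avoids truncated subtraction.\<close>

lemma dominating_cycle_iff:
  assumes "n > 0"
  shows "dominating_set (cycle_graph n) D \<longleftrightarrow> D \<subseteq> {0..<n} \<and>
    (\<forall>x. x mod n \<in> D \<or> (x + 1) mod n \<in> D \<or> (x + 2) mod n \<in> D)"
    (is "_ \<longleftrightarrow> _ \<and> (\<forall>x. ?dom x)")
proof (intro iffI conjI allI)
  assume dom: "dominating_set (cycle_graph n) D"
  then show sub: "D \<subseteq> {0..<n}"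
    by (simp add: dominating_set_def cycle_graph_def)
  fix x
  show "?dom x"
  proof (cases "(x + 1) mod n \<in> D")
    case False
    then obtain u where u: "u \<in> D" "adjacent (cycle_graph n) ((x + 1) mod n) u"
      using dom mod_less_divisor[OF assms, of "x + 1"]
      unfolding dominating_set_def by (fastforce simp: cycle_graph_def)
    then obtain j where j: "j < n" "{(x + 1) mod n, u} = {j, (j + 1) mod n}"
      by (auto simp: adjacent_def cycle_graph_def)
    then consider "u = (j + 1) mod n" "j = (x + 1) mod n"
      | "u = j" "(x + 1) mod n = (j + 1) mod n"
      by (auto simp: doubleton_eq_iff)
    then show ?thesis
    proof cases
      case 1
      then show ?thesis using u by (simp add: mod_simps)
    next
      case 2
      have "x mod n = j"
        using 2(2) mod_Suc_add_pred[OF assms, of x] mod_Suc_add_pred[OF assms, of j] j(1) by simp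
      then show ?thesis using u 2 by simp
    qed
  qed simp
next
  assume *: "D \<subseteq> {0..<n} \<and> (\<forall>x. ?dom x)"
  show "dominating_set (cycle_graph n) D"
    unfolding dominating_set_def
  proof (intro conjI ballI)
    show "D \<subseteq> vertices (cycle_graph n)"
      using * by (simp add: cycle_graph_def)
    fix v assume v: "v \<in> vertices (cycle_graph n) - D"
    then have vn: "v < n" "v \<notin> D" by (auto simp: cycle_graph_def)
    \<comment> \<open>\<open>w\<close> is the predecessor of \<open>v\<close>, so the criterion at
      \<open>w\<close> speaks of the closed neighbourhood of \<open>v\<close>.\<close>
    define w where "w = (v + (n - 1)) mod n"
    have w: "w < n" "(w + 1) mod n = v" "(w + 2) mod n = (v + 1) mod n"
      using vn mod_add_pred_Suc[of n v 0] mod_add_pred_Suc[of n v 1]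
      unfolding w_def by (simp_all add: mod_simps)
    have "w \<in> D \<or> (v + 1) mod n \<in> D"
      using *[THEN conjunct2, rule_format, of w] w vn by simp
    moreover have "{v, w} \<in> edges (cycle_graph n)"
      using w by (auto simp: cycle_graph_def insert_commute intro!: exI[of _ w])
    moreover have "{v, (v + 1) mod n} \<in> edges (cycle_graph n)"
      using vn by (auto simp: cycle_graph_def)
    ultimately show "\<exists>u\<in>D. adjacent (cycle_graph n) v u"
      by (auto simp: adjacent_def)
  qed
qed

text \<open>The ends need no separate case: \<open>x = y + 1\<close> fails at \<open>x = 0\<close>,
  and \<open>x + 1 \<in> D\<close> fails at \<open>x + 1 = m\<close> because \<open>D\<close> lies
  in \<open>{0..<m}\<close>.\<close>

lemma dominating_path_iff:
  "dominating_set (path_graph m) D \<longleftrightarrow> D \<subseteq> {0..<m} \<and>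
    (\<forall>x<m. x \<in> D \<or> x + 1 \<in> D \<or> (\<exists>y\<in>D. x = y + 1))"
proof -
  have adj: "adjacent (path_graph m) x u \<longleftrightarrow> u = x + 1 \<or> x = u + 1"
    if "x \<in> {0..<m}" "u \<in> {0..<m}" for x u
    using that by (auto simp: adjacent_def path_graph_def doubleton_eq_iff)
  have "(\<exists>u\<in>D. adjacent (path_graph m) x u) \<longleftrightarrow> x + 1 \<in> D \<or> (\<exists>y\<in>D. x = y + 1)"
    if "D \<subseteq> {0..<m}" "x \<in> {0..<m}" for x
    using adj[OF that(2)] that(1) by blast
  moreover have "vertices (path_graph m) = {0..<m}" by (simp add: path_graph_def)
  ultimately show ?thesis
    unfolding dominating_set_def by (metis DiffD1 DiffD2 DiffI atLeastLessThan_iff le0)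
qed

section \<open>Three consecutive vertices in an accurate dominating set\<close>

lemma accurate_cycle_three_consecutive:
  assumes n: "n > 0" and acc: "accurate_dominating_set (cycle_graph n) D"
    and card: "2 * card D \<le> n"
  shows "\<exists>x. x mod n \<in> D \<and> (x + 1) mod n \<in> D \<and> (x + 2) mod n \<in> D"
proof (rule ccontr)
  assume "\<not> ?thesis"
  then have no3: "\<not> (x mod n \<in> D \<and> (x + 1) mod n \<in> D \<and> (x + 2) mod n \<in> D)" for x
    by blast
  have sub: "D \<subseteq> {0..<n}"
    and dom: "x mod n \<in> D \<or> (x + 1) mod n \<in> D \<or> (x + 2) mod n \<in> D" for x
    using acc n by (auto simp: accurate_dominating_set_def dominating_cycle_iff)
  have fin: "finite D" using sub finite_subset by blast
  define f where "f d = (if (d + 1) mod n \<in> D then (d + (n - 1)) mod n else (d + 1) mod n)" for d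
  have next_in: "(y + 1) mod n \<in> f ` D" if "y mod n \<in> D" "(y + 1) mod n \<notin> D" for y
    using that by (auto simp: f_def mod_simps intro!: rev_image_eqI[of "y mod n"])
  have prev_in: "y mod n \<in> f ` D" if "(y + 1) mod n \<in> D" "(y + 2) mod n \<in> D" for y
  proof -
    have "((y + 1) mod n + 1) mod n = (y + 2) mod n" by (simp add: mod_simps)
    then have "f ((y + 1) mod n) = y mod n"
      using that mod_Suc_add_pred[OF n] by (simp add: f_def)
    then show ?thesis using that by (metis imageI)
  qed
  have disj: "f ` D \<subseteq> {0..<n} - D"
  proof
    fix w assume "w \<in> f ` D"
    then obtain d where d: "d \<in> D" "w = f d" by blast
    then have dn: "d < n" using sub by auto
    \<comment> \<open>Otherwise \<open>d\<close> and its two neighbours would be three consecutive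
      elements of \<open>D\<close>.\<close>
    have "(d + (n - 1)) mod n \<notin> D" if "(d + 1) mod n \<in> D"
    proof -
      have "(d + (n - 1) + 1) mod n = d" "(d + (n - 1) + 2) mod n = (d + 1) mod n"
        using dn mod_add_pred_Suc[OF n, of d 0] mod_add_pred_Suc[OF n, of d 1]
        by (simp_all add: numeral_eq_Suc)
      then show ?thesis using no3[of "d + (n - 1)"] that d(1) by metis
    qed
    then show "w \<in> {0..<n} - D" using d n by (auto simp: f_def)
  qed
  \<comment> \<open>If the centre \<open>x + 2\<close> is in \<open>D\<close>, then
    \<open>x + 3\<close> is its image or, when \<open>x + 3 \<in> D\<close>, \<open>x + 1\<close>
    is. If not, \<open>x + 2\<close> is the image of \<open>x + 1 \<in> D\<close>, or else
    \<open>x + 1\<close> is the image of \<open>x \<in> D\<close>.\<close>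
  have step: "(x + 1) mod n \<in> f ` D \<or> (x + 2) mod n \<in> f ` D \<or> (x + 3) mod n \<in> f ` D" for x
  proof (cases "(x + 2) mod n \<in> D")
    case True
    then show ?thesis
      using next_in[of "x + 2"] prev_in[of "x + 1"] by (simp only: add.assoc one_plus_numeral
          numeral_plus_one add_num_simps one_add_one) blast
  next
    case False
    then show ?thesis
      using next_in[of "x + 1"] next_in[of x] dom[of x] by (simp only: add.assoc one_add_one) blast
  qed
  have "dominating_set (cycle_graph n) (f ` D)"
    unfolding dominating_cycle_iff[OF n]
  proof (intro conjI allI)
    fix x
    have "(x + (n - 1) + 1) mod n = x mod n" "(x + (n - 1) + 2) mod n = (x + 1) mod n"
      "(x + (n - 1) + 3) mod n = (x + 2) mod n"
      using mod_add_pred_Suc[OF n, of x 0] mod_add_pred_Suc[OF n, of x 1]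
        mod_add_pred_Suc[OF n, of x 2]
      by (simp_all add: numeral_eq_Suc)
    then show "x mod n \<in> f ` D \<or> (x + 1) mod n \<in> f ` D \<or> (x + 2) mod n \<in> f ` D"
      using step[of "x + (n - 1)"] by metis
  qed (use disj in auto)
  moreover obtain T where T: "f ` D \<subseteq> T" "T \<subseteq> {0..<n} - D" "card T = card D"
  proof -
    have "card (f ` D) \<le> card D" using fin by (rule card_image_le)
    \<comment> \<open>As \<open>D\<close> has at most half of the vertices, its complement has room
      for a set of exactly the size that accuracy speaks of.\<close>
    moreover have "card D \<le> card ({0..<n} - D)"
      using sub fin card by (simp add: card_Diff_subset)
    ultimately show ?thesis
      using that exists_subset_between[of "f ` D" "card D" "{0..<n} - D"] disj by auto
  qed
  ultimately have "dominating_set (cycle_graph n) T"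
    by (rule_tac dominating_set_mono) (auto simp: cycle_graph_def)
  then show False
    using acc T by (auto simp: accurate_dominating_set_def cycle_graph_def)
qed

section \<open>Maximal runs and the path left after removing one\<close>

lemma inj_on_shift_mod: "inj_on (\<lambda>j. (p + j) mod n) {0..<n::nat}"
proof (rule linorder_inj_onI)
  fix a b assume ab: "a < b" "a \<in> {0..<n}" "b \<in> {0..<n}"
  have "\<not> n dvd b - a" using ab by (auto dest: dvd_imp_le)
  then show "(p + a) mod n \<noteq> (p + b) mod n"
    using ab mod_eq_dvd_iff_nat[of "p + a" "p + b" n] by (simp add: eq_commute[of "(p + a) mod n"])
qed auto

lemma image_shift_mod: "(\<lambda>j. (p + j) mod n) ` {0..<n} = {0..<n::nat}"
proof (rule card_subset_eq)
  show "(\<lambda>j. (p + j) mod n) ` {0..<n} \<subseteq> {0..<n}" by auto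
qed (simp_all add: card_image[OF inj_on_shift_mod])

text \<open>The gap vertex before the run has position \<open>p\<close>, the one after it position \<open>p + k + 1\<close>.\<close>

definition run_at :: "nat \<Rightarrow> nat \<Rightarrow> nat \<Rightarrow> nat set \<Rightarrow> bool" where
  "run_at n p k D \<longleftrightarrow> p mod n \<notin> D \<and> (\<forall>j\<in>{1..k}. (p + j) mod n \<in> D) \<and> (p + k + 1) mod n \<notin> D"

text \<open>Numbering from 0 makes the rest of \<open>D\<close> literally a vertex set of
  \<open>path_graph (n - k - 2)\<close>.\<close>

definition off_run :: "nat \<Rightarrow> nat \<Rightarrow> nat \<Rightarrow> nat set \<Rightarrow> nat set" where
  "off_run n p k D = {t. t < n - k - 2 \<and> (p + k + 2 + t) mod n \<in> D}"

text \<open>From the three given vertices one goes back to the nearest vertex outside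
  \<open>D\<close>, and from there forward to the next one.\<close>

lemma run_at_exists:
  assumes sub: "D \<subset> {0..<n}"
    and x: "x mod n \<in> D" "(x + 1) mod n \<in> D" "(x + 2) mod n \<in> D"
  shows "\<exists>p<n. \<exists>k\<ge>3. k < n \<and> run_at n p k D"
proof -
  obtain v where "v \<in> {0..<n}" "v \<notin> D" using sub by blast
  then have v: "v < n" "v \<notin> D" by auto
  \<comment> \<open>Searching back from \<open>x + n\<close> instead of \<open>x\<close> leaves a
    full turn above 0, so a vertex outside \<open>D\<close> is met.\<close>
  define y where "y = (GREATEST y. y \<le> x + n \<and> y mod n \<notin> D)"
  have "v \<in> (\<lambda>j. (x + j) mod n) ` {0..<n}" using image_shift_mod v by simp
  then obtain j where j: "j < n" "(x + j) mod n = v" by auto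
  have y: "y \<le> x + n \<and> y mod n \<notin> D"
    unfolding y_def by (rule GreatestI_nat[of _ "x + j" "x + n"]) (use j v in auto)
  have xn: "(x + n) mod n \<in> D" "(x + n + 1) mod n \<in> D" "(x + n + 2) mod n \<in> D"
    using x mod_add_self2[of "x + 1" n] mod_add_self2[of "x + 2" n] by (simp_all add: ac_simps)
  have after: "w mod n \<in> D" if "y < w" "w \<le> x + n + 2" for w
  proof (cases "w \<le> x + n")
    case True
    have "w \<le> y" if "w mod n \<notin> D"
      unfolding y_def by (rule Greatest_le_nat[of _ w "x + n"]) (use True that in auto)
    then show ?thesis using \<open>y < w\<close> by auto
  next
    case False
    then have "w = x + n + 1 \<or> w = x + n + 2" using that by auto
    then show ?thesis using xn by auto
  qed
  have ylt: "y < x + n" using y xn by (cases "y = x + n") auto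
  define k where "k = (LEAST k. (y + k + 1) mod n \<notin> D)"
  \<comment> \<open>A full turn leads back to \<open>y\<close>; this witness makes the
    \<open>LEAST\<close> meaningful and bounds \<open>k\<close>.\<close>
  have ex: "(y + (n - 1) + 1) mod n \<notin> D" using y v(1) by simp
  have k: "(y + k + 1) mod n \<notin> D"
    unfolding k_def by (rule LeastI[of "\<lambda>k. (y + k + 1) mod n \<notin> D", OF ex])
  have "k \<le> n - 1"
    unfolding k_def by (rule Least_le) (rule ex)
  then have "k < n" using v by simp
  have run: "(y + j) mod n \<in> D" if "j \<in> {1..k}" for j
    using not_less_Least[of "j - 1" "\<lambda>k. (y + k + 1) mod n \<notin> D"] that
    unfolding k_def[symmetric] by auto
  \<comment> \<open>All of \<open>y + 1\<close> up to \<open>x + n + 2\<close> lies in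
    \<open>D\<close> modulo \<open>n\<close>, and \<open>y < x + n\<close>, so the run covers the
    three given vertices.\<close>
  have "k \<ge> 3"
  proof (rule ccontr)
    assume "\<not> k \<ge> 3"
    then show False using after[of "y + k + 1"] k ylt by auto
  qed
  moreover have "run_at n (y mod n) k D"
    using k y run mod_add_left_eq[of y n "k + 1"] by (simp add: run_at_def mod_simps)
  moreover have "y mod n < n" using v by simp
  ultimately show ?thesis using \<open>k < n\<close> by blast
qed

text \<open>Counted from \<open>p\<close>, positions 0 and \<open>k + 1\<close> are gaps,
  \<open>1..k\<close> lie in \<open>D\<close>, and \<open>off_run\<close> records the rest. Hence
  \<open>off_run n p k D\<close> determines \<open>D\<close> once \<open>p\<close> and
  \<open>k\<close> are fixed.\<close>

lemma run_decomposition: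
  assumes "k + 2 \<le> n" and sub: "D \<subseteq> {0..<n}" and run: "run_at n p k D"
  shows "D = (\<lambda>j. (p + j) mod n) ` ({1..k} \<union> (\<lambda>t. t + k + 2) ` off_run n p k D)"
    and "card D = k + card (off_run n p k D)"
proof -
  let ?h = "\<lambda>j. (p + j) mod n" and ?J = "{1..k} \<union> (\<lambda>t. t + k + 2) ` off_run n p k D"
  have J: "?J = {j. j < n \<and> ?h j \<in> D}"
  proof (rule set_eqI)
    fix j
    consider "j = 0" | "j \<in> {1..k}" | "j = k + 1" | "k + 2 \<le> j" by force
    then show "j \<in> ?J \<longleftrightarrow> j \<in> {j. j < n \<and> ?h j \<in> D}"
    proof cases
      case 4
      then obtain t where "j = t + k + 2" by (metis add.commute add.assoc le_iff_add)
      then show ?thesis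
        using assms by (auto simp: off_run_def image_iff ac_simps)
    qed (use assms in \<open>auto simp: run_at_def off_run_def\<close>)
  qed
  show D: "D = ?h ` ?J"
    unfolding J using image_shift_mod[of p n] sub by fastforce
  have "inj_on ?h ?J"
    unfolding J by (rule inj_on_subset[OF inj_on_shift_mod]) auto
  then have "card D = card ?J" using D card_image by metis
  also have "\<dots> = card {1..k} + card ((\<lambda>t. t + k + 2) ` off_run n p k D)"
    by (rule card_Un_disjoint) (auto simp: off_run_def)
  also have "\<dots> = k + card (off_run n p k D)"
    by (simp add: card_image inj_on_def)
  finally show "card D = k + card (off_run n p k D)" .
qed

text \<open>The path is bordered by gap vertices on the cycle, so its ends are dominated from inside
  the path.\<close>

lemma dominating_off_run:
  assumes kn: "k + 2 \<le> n" and dom: "dominating_set (cycle_graph n) D" and run: "run_at n p k D"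
  shows "dominating_set (path_graph (n - k - 2)) (off_run n p k D)"
  unfolding dominating_path_iff
proof (intro conjI allI impI)
  show "off_run n p k D \<subseteq> {0..<n - k - 2}" by (auto simp: off_run_def)
  fix x assume x: "x < n - k - 2"
  \<comment> \<open>Path vertex \<open>x\<close> is the cycle vertex \<open>?m + 1\<close>; the
    cases are its left neighbour, itself and its right neighbour.\<close>
  let ?m = "p + k + 1 + x"
  have "?m mod n \<in> D \<or> (?m + 1) mod n \<in> D \<or> (?m + 2) mod n \<in> D"
    using dom kn by (simp add: dominating_cycle_iff)
  then consider (1) "?m mod n \<in> D" | (2) "(?m + 1) mod n \<in> D" | (3) "(?m + 2) mod n \<in> D"
    by blast
  then show "x \<in> off_run n p k D \<or> x + 1 \<in> off_run n p k D \<or> (\<exists>y\<in>off_run n p k D. x = y + 1)"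
  proof cases
    case 1
    then obtain y where "x = y + 1"
      using run by (cases x) (auto simp: run_at_def)
    then show ?thesis using 1 x by (auto simp: off_run_def)
  next
    case 2
    then show ?thesis using x by (auto simp: off_run_def)
  next
    case 3
    \<comment> \<open>To the right of the last path vertex comes \<open>p + n\<close>, which is the
      first gap again.\<close>
    have "x + 1 \<noteq> n - k - 2"
    proof
      assume "x + 1 = n - k - 2"
      then have "?m + 2 = p + n" using kn by simp
      then show False using 3 run by (metis mod_add_self2 run_at_def)
    qed
    then show ?thesis using 3 x by (auto simp: off_run_def)
  qed
qed

section \<open>Counting by position and length of the run\<close>

lemma card_dominating_with_run_le:
  assumes kn: "k + 2 \<le> n"
  shows "card {D. dominating_set (cycle_graph n) D \<and> card D = i \<and> run_at n p k D}
    \<le> num_dominating (path_graph (n - k - 2)) (i - k)" (is "card ?B \<le> _")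
  unfolding num_dominating_def
proof (rule card_inj_on_le)
  have sub: "D \<subseteq> {0..<n}" if "D \<in> ?B" for D
    using that kn by (simp add: dominating_cycle_iff)
  show "inj_on (off_run n p k) ?B"
  proof (rule inj_onI)
    fix D E assume DE: "D \<in> ?B" "E \<in> ?B" "off_run n p k D = off_run n p k E"
    then show "D = E"
      using run_decomposition(1)[OF kn, of D p] run_decomposition(1)[OF kn, of E p] sub by auto
  qed
  show "off_run n p k ` ?B \<subseteq> {D. dominating_set (path_graph (n - k - 2)) D \<and> card D = i - k}"
  proof (rule image_subsetI)
    fix D assume D: "D \<in> ?B"
    then have "card D = k + card (off_run n p k D)"
      using run_decomposition(2)[OF kn sub[OF D], of p] by blast
    then show "off_run n p k D \<in> {D. dominating_set (path_graph (n - k - 2)) D \<and> card D = i - k}"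
      using dominating_off_run[OF kn] D by auto
  qed
  have "{D. dominating_set (path_graph (n - k - 2)) D \<and> card D = i - k} \<subseteq> Pow {0..<n - k - 2}"
    by (auto simp: dominating_set_def path_graph_def)
  then show "finite {D. dominating_set (path_graph (n - k - 2)) D \<and> card D = i - k}"
    by (rule finite_subset) simp
qed

lemma accurate_cycle_run:
  assumes n: "n \<ge> 6" and acc: "accurate_dominating_set (cycle_graph n) D"
    and card: "2 * card D \<le> n"
  shows "\<exists>p<n. \<exists>k\<in>{3..card D - 1}. run_at n p k D"
proof -
  have dom: "dominating_set (cycle_graph n) D"
    using acc by (simp add: accurate_dominating_set_def)
  then have sub: "D \<subseteq> {0..<n}" using n by (simp add: dominating_cycle_iff)
  moreover have "D \<noteq> {0..<n}" using card n by auto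
  ultimately have psub: "D \<subset> {0..<n}" by blast
  have "n > 0" using n by simp
  then obtain x where "x mod n \<in> D" "(x + 1) mod n \<in> D" "(x + 2) mod n \<in> D"
    using accurate_cycle_three_consecutive[OF _ acc card] by blast
  then obtain p k where pk: "p < n" "3 \<le> k" "k < n" "run_at n p k D"
    using run_at_exists[OF psub] by blast
  \<comment> \<open>For \<open>k = n - 1\<close> both gap vertices coincide; such a run exceeds half
    of the cycle.\<close>
  have "k + 1 \<noteq> n"
  proof
    assume "k + 1 = n"
    then have "card ((\<lambda>j. (p + j) mod n) ` {1..k}) = k"
      by (subst card_image) (auto intro: inj_on_subset[OF inj_on_shift_mod])
    moreover have "(\<lambda>j. (p + j) mod n) ` {1..k} \<subseteq> D" using pk by (auto simp: run_at_def)
    ultimately have "k \<le> card D" using sub by (metis card_mono finite_atLeastLessThan finite_subset)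
    then show False using card \<open>k + 1 = n\<close> n by simp
  qed
  then have kn: "k + 2 \<le> n" using pk by simp
  have cardD: "card D = k + card (off_run n p k D)"
    by (rule run_decomposition(2)[OF kn sub pk(4)])
  have "off_run n p k D \<noteq> {}"
  proof
    assume empty: "off_run n p k D = {}"
    \<comment> \<open>Here \<open>card D = k\<close>, so \<open>2 * k \<le> n\<close> and
      \<open>n \<ge> 6\<close> leave a path vertex, which the empty set cannot dominate.\<close>
    then have "0 < n - k - 2" using cardD card n by simp
    then show False
      using dominating_off_run[OF kn dom pk(4)] unfolding empty dominating_path_iff by blast
  qed
  moreover have "finite (off_run n p k D)" by (simp add: off_run_def)
  ultimately have "k < card D" using cardD by (simp add: card_gt_0_iff)
  then have "k \<in> {3..card D - 1}" using pk by simp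
  then show ?thesis using pk by blast
qed

theorem theorem4p5:
  fixes n i :: nat
  assumes "n \<ge> 6"
    and "n div 3 + 2 \<le> i" and "i \<le> n div 2"
  shows "num_accurate_dominating (cycle_graph n) i
    \<le> (\<Sum>k = 3..i - 1. n * num_dominating (path_graph (n - k - 2)) (i - k))"
proof -
  \<comment> \<open>A set with several long runs lies in several \<open>B k p\<close>, so the union
    bound yields only an inequality.\<close>
  define B where
    "B k p = {D. dominating_set (cycle_graph n) D \<and> card D = i \<and> run_at n p k D}" for k p
  have "{D. dominating_set (cycle_graph n) D} \<subseteq> Pow {0..<n}"
    by (auto simp: dominating_set_def cycle_graph_def)
  then have fin: "finite {D. dominating_set (cycle_graph n) D}"
    by (rule finite_subset) simp
  have finB: "finite (\<Union>k\<in>{3..i - 1}. \<Union>p\<in>{0..<n}. B k p)"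
    by (rule finite_subset[OF _ fin]) (auto simp: B_def)
  have "{D. accurate_dominating_set (cycle_graph n) D \<and> card D = i}
      \<subseteq> (\<Union>k\<in>{3..i - 1}. \<Union>p\<in>{0..<n}. B k p)"
  proof clarify
    fix D assume D: "accurate_dominating_set (cycle_graph n) D" "i = card D"
    have "2 * card D \<le> n" using D assms(3) by linarith
    then obtain p k where "p < n" "k \<in> {3..card D - 1}" "run_at n p k D"
      using accurate_cycle_run[OF assms(1) D(1)] by auto
    then show "D \<in> (\<Union>k\<in>{3..card D - 1}. \<Union>p\<in>{0..<n}. B k p)"
      using D by (auto simp: B_def accurate_dominating_set_def)
  qed
  then have "num_accurate_dominating (cycle_graph n) i \<le> card (\<Union>k\<in>{3..i - 1}. \<Union>p\<in>{0..<n}. B k p)"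
    unfolding num_accurate_dominating_def by (rule card_mono[OF finB])
  also have "\<dots> \<le> (\<Sum>k = 3..i - 1. card (\<Union>p\<in>{0..<n}. B k p))"
    by (rule card_UN_le) simp
  also have "\<dots> \<le> (\<Sum>k = 3..i - 1. n * num_dominating (path_graph (n - k - 2)) (i - k))"
  proof (rule sum_mono)
    fix k assume "k \<in> {3..i - 1}"
    then have "k + 2 \<le> n" using assms by auto
    have "card (\<Union>p\<in>{0..<n}. B k p) \<le> (\<Sum>p = 0..<n. card (B k p))"
      by (rule card_UN_le) simp
    also have "\<dots> \<le> (\<Sum>p = 0..<n. num_dominating (path_graph (n - k - 2)) (i - k))"
      unfolding B_def by (intro sum_mono card_dominating_with_run_le \<open>k + 2 \<le> n\<close>)
    finally show "card (\<Union>p\<in>{0..<n}. B k p) \<le> n * num_dominating (path_graph (n - k - 2)) (i - k)"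
      by simp
  qed
  finally show ?thesis .
qed

end
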